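(* Let $\nu\ge 1$ and $\sigma>0$. (i) Let the sequences $(s_d,a_d)_{d\geq 1}$ be such that $d -s_d\to \infty$ and $$a_d \geq \sigma \Big( (\nu \log(d-s_d) + \nu \log\log(d-s_d))^{1/\nu} + (\nu \log(s_d) + \nu \log\log(d-s_d))^{1/\nu} \Big)$$ for all $d$ large enough. Then the selector $\hat\eta = \hat{\eta}_{\nu}(d-s_d)$ satisfies $$\limsup_{d\to \infty} \sup_{F \in \mathcal{P}_\nu}\sup_{\mu \in \Theta_{d} (s_d,a_d)} \mathbf{E}_{\mu,F} |\hat \eta - \eta(\mu)| =0 \quad\text{and}\quad \limsup_{d\to \infty} \sup_{F \in \mathcal{P}_\nu} \sup_{\mu \in \Theta_{d} (s_d,a_d)} \mathbf{P}_{\mu,F} (S_{\hat \eta} \ne S_{\eta(\mu)}) =0.$$ (ii) If the sequences $(s_d,a_d)_{d\geq 1}$ are such that $d/s_d\to \infty$ and $$a_d \geq \sigma \Big((\nu \log(d/s_d-1) + \nu \log\log(d/s_d-1))^{1/\nu} + ( \nu \log\log(d/s_d-1))^{1/\nu} \Big)$$ for all $d$ large enough, then the selector $\hat\eta = \hat{\eta}_{\nu}(d/s_d-1)$ satisfies $$\limsup_{d \to \infty} \sup_{F \in \mathcal{P}_\nu} \sup_{\mu \in \Theta_{d} (s_d,a_d)} \frac{1}{s_d} \mathbf{E}_{\mu,F} |\hat \eta - \eta(\mu)| =0.$$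
   Context: Location model: one observes $X_i=\mu_i+\sigma\xi_i$, $i=1,\dots,d$, where $\sigma>0$ and $\xi_1,\dots,\xi_d$ are i.i.d. with c.d.f. $F$. For $\nu\ge1$, $$\mathcal{P}_\nu=\{F:\mathbb{R}\to[0,1]\ \text{c.d.f.}:\ 1-F(u)\le e^{-|u|^\nu/\nu}\ \text{and}\ F(-u)\le e^{-|u|^\nu/\nu}\ \ \forall u\ge0\}.$$ For $a>0$ and integer $1\le s<d$, $$\Theta_d(s,a)=\{\mu\in\mathbb{R}^d:\ \exists S\subset\{1,\dots,d\},\ |S|=s,\ \mu_j\ge a\ \text{for } j\in S,\ \mu_j=0\ \text{for } j\notin S\}.$$ For $\mu\in\Theta_d(s,a)$, $\eta(\mu)\in\{0,1\}^d$ has components $\eta_j(\mu)=\mathbf{1}(\mu_j\neq0)$. $\mathbf{P}_{\mu,F}$, $\mathbf{E}_{\mu,F}$ are the probability and expectation for the observations. $|\hat\eta-\eta|=\sum_{j=1}^d\mathbf{1}(\hat\eta_j\neq\eta_j)$ and $S_\eta=\{j:\eta_j\neq0\}$. For $\nu\ge1$ and $x>e$ the thresholding selector $\hat\eta_\nu(x)$ has components $$\hat\eta_{\nu,i}(x)=\mathbf{1}\big(X_i\ge\sigma(\nu\log(x)+\nu\log\log(x))^{1/\nu}\big),\quad i=1,\dots,d$$ (in the claim the argument $x$ exceeds $e$ for all $d$ large enough). Here $s_d$ are integers with $1\le s_d<d$ and $a_d>0$. *)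

theory Defs
  imports "HOL-Probability.Probability"
begin

definition noise_cdfs :: "real \<Rightarrow> (real \<Rightarrow> real) set" where
  "noise_cdfs \<nu> = {F. (\<exists>M. real_distribution M \<and> F = cdf M) \<and>
     (\<forall>u\<ge>0. 1 - F u \<le> exp (- (\<bar>u\<bar> powr \<nu> / \<nu>)) \<and> F (- u) \<le> exp (- (\<bar>u\<bar> powr \<nu> / \<nu>)))}"

text \<open>Vectors of dimension \<open>d\<close> are functions on the index set \<open>{1..d}\<close>,
  extensional (i.e. \<open>undefined\<close> outside it) as in the product measure \<open>PiM\<close>.\<close>

definition sparse_means :: "nat \<Rightarrow> nat \<Rightarrow> real \<Rightarrow> (nat \<Rightarrow> real) set" where
  "sparse_means d s a = {\<mu> \<in> {1..d} \<rightarrow>\<^sub>E UNIV. \<exists>S\<subseteq>{1..d}. card S = s \<and>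
     (\<forall>j\<in>S. \<mu> j \<ge> a) \<and> (\<forall>j\<in>{1..d} - S. \<mu> j = 0)}"

definition pattern :: "nat \<Rightarrow> (nat \<Rightarrow> real) \<Rightarrow> (nat \<Rightarrow> nat)" where
  "pattern d \<mu> = (\<lambda>j\<in>{1..d}. of_bool (\<mu> j \<noteq> 0))"

text \<open>The joint law of \<open>X\<^sub>i = \<mu>\<^sub>i + \<sigma> \<xi>\<^sub>i\<close>, \<open>i = 1, \<dots>, d\<close>. For a c.d.f. \<open>F\<close>,
  \<open>interval_measure F\<close> is the distribution with c.d.f. \<open>F\<close>, see
  \<open>noise_cdfs_interval_measure\<close> below.\<close>

definition obs_law :: "nat \<Rightarrow> real \<Rightarrow> (nat \<Rightarrow> real) \<Rightarrow> (real \<Rightarrow> real) \<Rightarrow> (nat \<Rightarrow> real) measure" where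
  "obs_law d \<sigma> \<mu> F =
     distr (PiM {1..d} (\<lambda>i. interval_measure F)) (PiM {1..d} (\<lambda>i. borel))
       (\<lambda>\<xi>. \<lambda>i\<in>{1..d}. \<mu> i + \<sigma> * \<xi> i)"

definition threshold_selector :: "nat \<Rightarrow> real \<Rightarrow> real \<Rightarrow> real \<Rightarrow> (nat \<Rightarrow> real) \<Rightarrow> (nat \<Rightarrow> nat)" where
  "threshold_selector d \<sigma> \<nu> x X =
     (\<lambda>i\<in>{1..d}. of_bool (X i \<ge> \<sigma> * (\<nu> * ln x + \<nu> * ln (ln x)) powr (1 / \<nu>)))"

definition hamming :: "nat \<Rightarrow> (nat \<Rightarrow> nat) \<Rightarrow> (nat \<Rightarrow> nat) \<Rightarrow> real" where
  "hamming d \<eta>' \<eta> = (\<Sum>j=1..d. of_bool (\<eta>' j \<noteq> \<eta> j))"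

definition supp :: "nat \<Rightarrow> (nat \<Rightarrow> nat) \<Rightarrow> nat set" where
  "supp d \<eta> = {j\<in>{1..d}. \<eta> j \<noteq> 0}"

lemma noise_cdfs_interval_measure:
  assumes "F \<in> noise_cdfs \<nu>"
  shows "real_distribution (interval_measure F)" and "cdf (interval_measure F) = F"
proof -
  obtain M where M: "real_distribution M" "F = cdf M"
    using assms by (auto simp: noise_cdfs_def)
  interpret real_distribution M by fact
  show rd: "real_distribution (interval_measure F)"
    unfolding M(2)
    by (intro real_distribution_interval_measure cdf_nondecreasing cdf_is_right_cont
        cdf_lim_at_bot cdf_lim_at_top_prob)
  show "cdf (interval_measure F) = F"
    unfolding M(2)
    by (intro cdf_interval_measure cdf_nondecreasing cdf_is_right_cont cdf_lim_at_bot)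
qed

lemma noise_cdfs_nonempty:
  assumes "\<nu> \<ge> 1"
  shows "noise_cdfs \<nu> \<noteq> {}"
proof -
  let ?M = "return borel (0::real)"
  have "real_distribution ?M"
    by (simp add: real_distribution_def real_distribution_axioms_def prob_space_return)
  moreover have "cdf ?M = (\<lambda>x. of_bool (x \<ge> 0))"
    by (auto simp: cdf_def measure_return fun_eq_iff indicator_def)
  ultimately have "(\<lambda>x::real. of_bool (x \<ge> 0)) \<in> noise_cdfs \<nu>"
    using assms by (auto simp: noise_cdfs_def intro!: exI[of _ ?M])
  then show ?thesis by blast
qed

lemma prob_space_obs_law:
  assumes "F \<in> noise_cdfs \<nu>"
  shows "prob_space (obs_law d \<sigma> \<mu> F)"
proof -
  interpret N: real_distribution "interval_measure F"
    by (rule noise_cdfs_interval_measure[OF assms])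
  interpret P: product_prob_space "\<lambda>i::nat. interval_measure F" "{1..d}"
    by unfold_locales
  show ?thesis
    unfolding obs_law_def
    by (rule P.prob_space_distr) measurable
qed

lemma sparse_means_nonempty:
  assumes "s \<le> d"
  shows "sparse_means d s a \<noteq> {}"
proof -
  have "(\<lambda>j\<in>{1..d}. if j \<le> s then a else 0) \<in> sparse_means d s a"
    using assms unfolding sparse_means_def by (auto intro!: exI[of _ "{1..s}"])
  then show ?thesis by blast
qed

lemma threshold_selector_measurable:
  assumes "j \<in> {1..d}"
  shows "Measurable.pred (obs_law d \<sigma> \<mu> F) (\<lambda>X. threshold_selector d \<sigma> \<nu> x X j = k)"
proof -
  have [measurable]: "(\<lambda>X. X j) \<in> borel_measurable (PiM {1..d} (\<lambda>i. borel :: real measure))"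
    using assms by (rule measurable_component_singleton)
  show ?thesis
    using assms unfolding obs_law_def threshold_selector_def by simp
qed

lemma integrable_hamming_threshold_selector:
  assumes "F \<in> noise_cdfs \<nu>'"
  shows "integrable (obs_law d \<sigma> \<mu> F) (\<lambda>X. hamming d (threshold_selector d \<sigma> \<nu> x X) \<eta>)"
proof -
  interpret prob_space "obs_law d \<sigma> \<mu> F"
    by (rule prob_space_obs_law[OF assms])
  have "integrable (obs_law d \<sigma> \<mu> F) (\<lambda>X. of_bool (threshold_selector d \<sigma> \<nu> x X j \<noteq> \<eta> j) :: real)"
    if "j \<in> {1..d}" for j
  proof (rule integrable_const_bound[where B = 1])
    note [measurable] = threshold_selector_measurable[OF that]
    show "(\<lambda>X. of_bool (threshold_selector d \<sigma> \<nu> x X j \<noteq> \<eta> j) :: real)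
        \<in> borel_measurable (obs_law d \<sigma> \<mu> F)"
      unfolding of_bool_def by measurable
  qed auto
  then show ?thesis
    unfolding hamming_def by (intro Bochner_Integration.integrable_sum)
qed

end

theory Submission
  imports Defs
begin

text \<open>For \<open>x > exp 1\<close> the threshold \<open>u\<close> (in units of \<open>\<sigma>\<close>) satisfies
  \<open>exp (- u powr \<nu> / \<nu>) = 1 / (x * ln x)\<close>, which bounds the probability of a false positive.
  Since \<open>a \<ge> \<sigma> (u + v)\<close> with \<open>v\<close> the second root in the signal bound, missing a true
  signal forces the noise below \<open>- v\<close>, an event of probability at most
  \<open>exp (- v powr \<nu> / \<nu>) = 1 / (m * ln x)\<close>, with \<open>m = s\<close> in part (i) and \<open>m = 1\<close> in part (ii).
  Summing over the coordinates bounds the (normalized) expected Hamming loss by \<open>2 / ln x\<close> uniformly,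
  and Markov's inequality passes to the probability of wrong support recovery.\<close>

section \<open>Tails of the noise and the law of a single observation\<close>

text \<open>The class constrains \<open>1 - F u\<close>, the probability of \<open>\<xi> > u\<close>; the atom at \<open>u\<close> is handled by
  continuity of the bound, which is why \<open>u > 0\<close> is required.\<close>

lemma noise_cdfs_upper_tail:
  assumes F: "F \<in> noise_cdfs \<nu>" and u: "u > 0"
  shows "measure (interval_measure F) {u..} \<le> exp (- (u powr \<nu> / \<nu>))"
proof -
  interpret N: real_distribution "interval_measure F"
    by (rule noise_cdfs_interval_measure[OF F])
  have bound: "measure (interval_measure F) {u..} \<le> exp (- (v powr \<nu> / \<nu>))" if "0 < v" "v < u" for v
  proof -
    have "measure (interval_measure F) {u..} \<le> measure (interval_measure F) (space (interval_measure F) - {..v})"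
      using that by (intro N.finite_measure_mono) auto
    also have "\<dots> = 1 - cdf (interval_measure F) v"
      by (subst N.prob_compl) (auto simp: cdf_def)
    also have "\<dots> = 1 - F v"
      by (simp add: noise_cdfs_interval_measure[OF F])
    also have "\<dots> \<le> exp (- (v powr \<nu> / \<nu>))"
      using F that by (auto simp: noise_cdfs_def dest!: spec[of _ v])
    finally show ?thesis .
  qed
  have "((\<lambda>v. exp (- (v powr \<nu> / \<nu>))) \<longlongrightarrow> exp (- (u powr \<nu> / \<nu>))) (at_left u)"
    unfolding divide_inverse using u by (intro tendsto_intros) auto
  moreover have "\<forall>\<^sub>F v in at_left u. measure (interval_measure F) {u..} \<le> exp (- (v powr \<nu> / \<nu>))"
    using eventually_at_left_real[OF u] by eventually_elim (rule bound, auto)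
  ultimately show ?thesis
    by (rule tendsto_lowerbound) simp
qed

lemma noise_cdfs_lower_tail:
  assumes F: "F \<in> noise_cdfs \<nu>" and u: "u \<ge> 0"
  shows "measure (interval_measure F) {..<- u} \<le> exp (- (u powr \<nu> / \<nu>))"
proof -
  interpret N: real_distribution "interval_measure F"
    by (rule noise_cdfs_interval_measure[OF F])
  have "measure (interval_measure F) {..<- u} \<le> cdf (interval_measure F) (- u)"
    unfolding cdf_def by (intro N.finite_measure_mono) auto
  also have "\<dots> = F (- u)"
    by (simp add: noise_cdfs_interval_measure[OF F])
  also have "\<dots> \<le> exp (- (u powr \<nu> / \<nu>))"
    using F u by (auto simp: noise_cdfs_def dest!: spec[of _ u])
  finally show ?thesis .
qed

text \<open>An error at coordinate \<open>j\<close> depends on \<open>X j\<close> alone. This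
  reduces its probability to the one-dimensional noise law, because each marginal of a product of
  probability measures is the corresponding factor.\<close>

lemma measure_obs_law_component:
  assumes F: "F \<in> noise_cdfs \<nu>" and j: "j \<in> {1..d}" and A: "A \<in> sets borel"
  shows "measure (obs_law d \<sigma> \<mu> F) {X \<in> space (obs_law d \<sigma> \<mu> F). X j \<in> A}
    = measure (interval_measure F) {\<xi>. \<mu> j + \<sigma> * \<xi> \<in> A}"
proof -
  interpret N: real_distribution "interval_measure F"
    by (rule noise_cdfs_interval_measure[OF F])
  interpret P: product_prob_space "\<lambda>i::nat. interval_measure F" "{1..d}"
    by unfold_locales
  let ?P = "PiM {1..d} (\<lambda>i. interval_measure F)"
  let ?B = "PiM {1..d} (\<lambda>i. borel :: real measure)"
  let ?f = "\<lambda>\<xi>. \<lambda>i\<in>{1..d}. \<mu> i + \<sigma> * \<xi> i"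
  have "(\<lambda>X. X j) \<in> borel_measurable ?B"
    using j by (rule measurable_component_singleton)
  then have "{X \<in> space ?B. X j \<in> A} \<in> sets ?B"
    using A by measurable
  have f: "?f \<in> measurable ?P ?B"
  proof (rule measurable_restrict)
    fix i assume "i \<in> {1..d}"
    then have "(\<lambda>\<xi>. \<xi> i) \<in> measurable ?P (interval_measure F)"
      by (rule measurable_component_singleton)
    then have [measurable]: "(\<lambda>\<xi>. \<xi> i) \<in> borel_measurable ?P"
      by (simp cong: measurable_cong_sets)
    show "(\<lambda>\<xi>. \<mu> i + \<sigma> * \<xi> i) \<in> borel_measurable ?P"
      by measurable
  qed
  have "measure (obs_law d \<sigma> \<mu> F) {X \<in> space (obs_law d \<sigma> \<mu> F). X j \<in> A}
      = measure ?P (?f -` {X \<in> space ?B. X j \<in> A} \<inter> space ?P)"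
    unfolding obs_law_def space_distr by (rule measure_distr[OF f]) fact
  \<comment> \<open>Restriction makes every image extensional, so membership in
    \<open>space ?B\<close> is automatic and only coordinate \<open>j\<close> is
    constrained.\<close>
  also have "?f -` {X \<in> space ?B. X j \<in> A} \<inter> space ?P
      = (\<lambda>\<xi>. \<xi> j) -` {\<xi>. \<mu> j + \<sigma> * \<xi> \<in> A} \<inter> space ?P"
    using j by (auto simp: space_PiM)
  also have "measure ?P \<dots> = measure (distr ?P (interval_measure F) (\<lambda>\<xi>. \<xi> j)) {\<xi>. \<mu> j + \<sigma> * \<xi> \<in> A}"
    using j A by (subst measure_distr) (auto intro: measurable_component_singleton)
  also have "distr ?P (interval_measure F) (\<lambda>\<xi>. \<xi> j) = interval_measure F"
    by (rule P.PiM_component[OF j])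
  finally show ?thesis .
qed

section \<open>Hamming loss of the selector for fixed dimension\<close>

abbreviation (input) sel_threshold :: "real \<Rightarrow> real \<Rightarrow> real" where
  "sel_threshold \<nu> x \<equiv> (\<nu> * ln x + \<nu> * ln (ln x)) powr (1 / \<nu>)"

lemma hamming_nonneg: "hamming d \<eta> \<eta>' \<ge> 0"
  unfolding hamming_def by (intro sum_nonneg) auto

text \<open>By linearity of expectation the loss splits into false positives off the support and
  missed signals on it. The margin \<open>v\<close> stays free because the two regimes use different
  ones.\<close>

lemma expected_hamming_threshold_le:
  assumes F: "F \<in> noise_cdfs \<nu>" and \<mu>: "\<mu> \<in> sparse_means d s a"
    and \<sigma>: "\<sigma> > 0" and a: "a > 0"
    and u: "sel_threshold \<nu> x > 0" and v: "v \<ge> 0"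
    and sep: "a \<ge> \<sigma> * (sel_threshold \<nu> x + v)"
  shows "integral\<^sup>L (obs_law d \<sigma> \<mu> F) (\<lambda>X. hamming d (threshold_selector d \<sigma> \<nu> x X) (pattern d \<mu>))
    \<le> (real d - real s) * exp (- (sel_threshold \<nu> x powr \<nu> / \<nu>)) + real s * exp (- (v powr \<nu> / \<nu>))"
proof -
  interpret N: real_distribution "interval_measure F"
    by (rule noise_cdfs_interval_measure[OF F])
  interpret O: prob_space "obs_law d \<sigma> \<mu> F"
    by (rule prob_space_obs_law[OF F])
  let ?O = "obs_law d \<sigma> \<mu> F" and ?u = "sel_threshold \<nu> x"
  let ?err = "\<lambda>j X. threshold_selector d \<sigma> \<nu> x X j \<noteq> pattern d \<mu> j"
  let ?p = "exp (- (?u powr \<nu> / \<nu>))" and ?q = "exp (- (v powr \<nu> / \<nu>))"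
  obtain S where S: "S \<subseteq> {1..d}" "card S = s" "\<And>j. j \<in> S \<Longrightarrow> \<mu> j \<ge> a"
      "\<And>j. j \<in> {1..d} - S \<Longrightarrow> \<mu> j = 0"
    using \<mu> by (auto simp: sparse_means_def)
  have meas: "{X \<in> space ?O. ?err j X} \<in> O.events" if "j \<in> {1..d}" for j
  proof -
    note [measurable] = threshold_selector_measurable[OF that]
    show ?thesis by measurable
  qed
  have fp_event: "{\<xi>. 0 + \<sigma> * \<xi> \<in> {\<sigma> * y..}} = {y..}" for y
    using \<sigma> by auto
  have fp: "O.prob {X \<in> space ?O. ?err j X} \<le> ?p" if j: "j \<in> {1..d} - S" for j
  proof -
    have "{X \<in> space ?O. ?err j X} = {X \<in> space ?O. X j \<in> {\<sigma> * ?u..}}"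
      using j S(4)[OF j] by (auto simp: threshold_selector_def pattern_def)
    then have "O.prob {X \<in> space ?O. ?err j X} = O.prob {X \<in> space ?O. X j \<in> {\<sigma> * ?u..}}"
      by (rule arg_cong)
    also have "\<dots> = N.prob {\<xi>. \<mu> j + \<sigma> * \<xi> \<in> {\<sigma> * ?u..}}"
      using j by (intro measure_obs_law_component[OF F]) auto
    also have "\<dots> = N.prob {?u..}"
      by (simp only: S(4)[OF j] fp_event)
    also have "\<dots> \<le> ?p"
      by (rule noise_cdfs_upper_tail[OF F u])
    finally show ?thesis .
  qed
  have fn: "O.prob {X \<in> space ?O. ?err j X} \<le> ?q" if j: "j \<in> S" for j
  proof -
    have jd: "j \<in> {1..d}" using j S(1) by auto
    \<comment> \<open>Positivity of \<open>a\<close> makes the pattern equal to 1 on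
      \<open>S\<close>, so an error there is exactly a value below the threshold.\<close>
    have "{X \<in> space ?O. ?err j X} = {X \<in> space ?O. X j \<in> {..<\<sigma> * ?u}}"
      using jd S(3)[OF j] a by (auto simp: threshold_selector_def pattern_def)
    then have "O.prob {X \<in> space ?O. ?err j X} = O.prob {X \<in> space ?O. X j \<in> {..<\<sigma> * ?u}}"
      by (rule arg_cong)
    also have "\<dots> = N.prob {\<xi>. \<mu> j + \<sigma> * \<xi> \<in> {..<\<sigma> * ?u}}"
      using jd by (intro measure_obs_law_component[OF F]) auto
    also have "\<dots> \<le> N.prob {..<- v}"
    proof (intro N.finite_measure_mono subsetI)
      fix \<xi> assume "\<xi> \<in> {\<xi>. \<mu> j + \<sigma> * \<xi> \<in> {..<\<sigma> * ?u}}"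
      \<comment> \<open>A miss gives sigma xi < sigma u - mu_j, and mu_j >= a >= sigma (u + v),
        where u is the threshold.\<close>
      then have "\<sigma> * \<xi> < \<sigma> * (- v)"
        using sep S(3)[OF j] by (simp add: distrib_left)
      then show "\<xi> \<in> {..<- v}" using \<sigma> by (simp only: mult_less_cancel_left_pos lessThan_iff)
    qed auto
    also have "\<dots> \<le> ?q"
      by (rule noise_cdfs_lower_tail[OF F v])
    finally show ?thesis .
  qed
  have "integral\<^sup>L ?O (\<lambda>X. hamming d (threshold_selector d \<sigma> \<nu> x X) (pattern d \<mu>))
      = integral\<^sup>L ?O (\<lambda>X. \<Sum>j=1..d. indicator {X \<in> space ?O. ?err j X} X)"
    unfolding hamming_def by (intro Bochner_Integration.integral_cong sum.cong) (auto simp: indicator_def)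
  also have "\<dots> = (\<Sum>j=1..d. integral\<^sup>L ?O (indicator {X \<in> space ?O. ?err j X}))"
    by (intro Bochner_Integration.integral_sum integrable_real_indicator meas)
      (simp_all add: O.emeasure_eq_measure)
  also have "\<dots> = (\<Sum>j=1..d. O.prob {X \<in> space ?O. ?err j X})"
    by (intro sum.cong refl) (simp, rule arg_cong[of _ _ O.prob], blast)
  also have "\<dots> = (\<Sum>j\<in>{1..d} - S. O.prob {X \<in> space ?O. ?err j X}) + (\<Sum>j\<in>S. O.prob {X \<in> space ?O. ?err j X})"
    using S(1) by (intro sum.subset_diff) auto
  also have "\<dots> \<le> real (card ({1..d} - S)) * ?p + real (card S) * ?q"
    using fp fn by (intro add_mono sum_bounded_above) auto
  also have "real (card ({1..d} - S)) = real d - real s"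
    using S(1,2) card_mono[of "{1..d}" S] by (simp add: card_Diff_subset finite_subset of_nat_diff)
  finally show ?thesis by (simp add: S(2))
qed

text \<open>Distinct supports force a wrong coordinate, hence a loss of at least 1, and Markov's
  inequality applies at level 1.\<close>

lemma prob_supp_neq_le_expected_hamming:
  assumes F: "F \<in> noise_cdfs \<nu>'"
  shows "measure (obs_law d \<sigma> \<mu> F) {X \<in> space (obs_law d \<sigma> \<mu> F).
      supp d (threshold_selector d \<sigma> \<nu> x X) \<noteq> supp d \<eta>}
    \<le> integral\<^sup>L (obs_law d \<sigma> \<mu> F) (\<lambda>X. hamming d (threshold_selector d \<sigma> \<nu> x X) \<eta>)"
proof -
  interpret O: prob_space "obs_law d \<sigma> \<mu> F"
    by (rule prob_space_obs_law[OF F])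
  let ?O = "obs_law d \<sigma> \<mu> F" and ?h = "\<lambda>X. hamming d (threshold_selector d \<sigma> \<nu> x X) \<eta>"
  note int = integrable_hamming_threshold_selector[OF F, of d \<sigma> \<mu> \<nu> x \<eta>]
  have "{X \<in> space ?O. supp d (threshold_selector d \<sigma> \<nu> x X) \<noteq> supp d \<eta>} \<subseteq> {X \<in> space ?O. ?h X \<ge> 1}"
  proof (intro subsetI CollectI conjI; elim CollectE conjE)
    fix X assume "supp d (threshold_selector d \<sigma> \<nu> x X) \<noteq> supp d \<eta>"
    then obtain j where j: "j \<in> {1..d}" "threshold_selector d \<sigma> \<nu> x X j \<noteq> \<eta> j"
      unfolding supp_def by force
    have "(1::real) = of_bool (threshold_selector d \<sigma> \<nu> x X j \<noteq> \<eta> j)" using j by simp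
    also have "\<dots> \<le> ?h X"
      unfolding hamming_def using j by (intro member_le_sum) auto
    finally show "?h X \<ge> 1" .
  qed
  then have "O.prob {X \<in> space ?O. supp d (threshold_selector d \<sigma> \<nu> x X) \<noteq> supp d \<eta>}
      \<le> O.prob {X \<in> space ?O. ?h X \<ge> 1}"
    \<comment> \<open>Monotonicity asks for measurability of the larger event only.\<close>
    using borel_measurable_integrable[OF int] by (intro O.finite_measure_mono) auto
  also have "\<dots> \<le> integral\<^sup>L ?O ?h / 1"
    using int by (intro integral_Markov_inequality_measure[where A = "space ?O"]) (auto simp: hamming_nonneg)
  finally show ?thesis by simp
qed

section \<open>Passage from uniform bounds to the limsup of suprema\<close>

lemma limsup_SUP_SUP_eq_0:
  fixes f :: "nat \<Rightarrow> 'a \<Rightarrow> 'b \<Rightarrow> real" and c :: "nat \<Rightarrow> real"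
  assumes A: "A \<noteq> {}" and B: "\<forall>\<^sub>F n in sequentially. B n \<noteq> {}"
    and nonneg: "\<And>n x y. x \<in> A \<Longrightarrow> y \<in> B n \<Longrightarrow> 0 \<le> f n x y"
    and le: "\<forall>\<^sub>F n in sequentially. \<forall>x\<in>A. \<forall>y\<in>B n. f n x y \<le> c n"
    and c: "c \<longlonglongrightarrow> 0"
  shows "limsup (\<lambda>n. SUP x\<in>A. SUP y\<in>B n. ereal (f n x y)) = 0"
proof -
  let ?S = "\<lambda>n. SUP x\<in>A. SUP y\<in>B n. ereal (f n x y)"
  have "?S \<longlonglongrightarrow> 0"
  proof (rule tendsto_sandwich)
    \<comment> \<open>The supremum of an empty set in \<open>ereal\<close> is minus infinity, so
      this lower bound needs a point in each index set.\<close>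
    show "\<forall>\<^sub>F n in sequentially. 0 \<le> ?S n"
      using B
    proof eventually_elim
      case (elim n)
      then obtain x y where "x \<in> A" "y \<in> B n" using A by blast
      then show ?case
        using nonneg[of x y n] by (intro SUP_upper2[of x] SUP_upper2[of y]) auto
    qed
    show "\<forall>\<^sub>F n in sequentially. ?S n \<le> ereal (c n)"
      using le by eventually_elim (auto intro!: SUP_least)
    show "(\<lambda>n. ereal (c n)) \<longlonglongrightarrow> 0"
      using c by (simp add: zero_ereal_def)
  qed simp
  then show ?thesis by (intro lim_imp_Limsup) simp_all
qed

section \<open>Error bounds at the actual thresholds\<close>

lemma exp_neg_powr_root:
  fixes \<nu> y :: real
  assumes "\<nu> > 0" "y \<ge> 0"
  shows "exp (- (((\<nu> * y) powr (1 / \<nu>)) powr \<nu> / \<nu>)) = exp (- y)"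
proof -
  have "((\<nu> * y) powr (1 / \<nu>)) powr \<nu> = (\<nu> * y) powr 1"
    using assms by (subst powr_powr) simp
  then show ?thesis using assms by simp
qed

text \<open>Free \<open>x\<close> and \<open>m\<close> let one bound serve both regimes: x = d - s,
  m = s gives (1 + 1) / ln x, while x = d/s - 1, m = 1 gives (s + s) / ln x, to be divided by
  s.\<close>

lemma expected_hamming_threshold_le_ln:
  assumes F: "F \<in> noise_cdfs \<nu>" and \<mu>: "\<mu> \<in> sparse_means d s a"
    and \<nu>: "\<nu> \<ge> 1" and \<sigma>: "\<sigma> > 0" and a: "a > 0" and x: "x > exp 1" and m: "m \<ge> 1"
    and sep: "a \<ge> \<sigma> * (sel_threshold \<nu> x + (\<nu> * ln m + \<nu> * ln (ln x)) powr (1 / \<nu>))"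
  shows "integral\<^sup>L (obs_law d \<sigma> \<mu> F) (\<lambda>X. hamming d (threshold_selector d \<sigma> \<nu> x X) (pattern d \<mu>))
    \<le> ((real d - real s) / x + real s / m) / ln x"
proof -
  have x0: "x > 1" using x one_less_exp_iff[of "1::real"] by linarith
  have ln1: "ln x > 1" using ln_less_cancel_iff[of "exp 1" x] x x0 by simp
  then have lnln: "ln (ln x) > 0" by simp
  have "exp (- (sel_threshold \<nu> x powr \<nu> / \<nu>)) = exp (- (ln x + ln (ln x)))"
    unfolding distrib_left[symmetric] using \<nu> ln1 lnln by (intro exp_neg_powr_root) auto
  also have "\<dots> = 1 / (x * ln x)"
    using x0 ln1 by (subst exp_minus, subst exp_add) (auto simp: inverse_eq_divide)
  finally have p: "exp (- (sel_threshold \<nu> x powr \<nu> / \<nu>)) = 1 / (x * ln x)" .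
  have "exp (- (((\<nu> * ln m + \<nu> * ln (ln x)) powr (1 / \<nu>)) powr \<nu> / \<nu>)) = exp (- (ln m + ln (ln x)))"
    unfolding distrib_left[symmetric] using \<nu> m lnln by (intro exp_neg_powr_root) auto
  also have "\<dots> = 1 / (m * ln x)"
    using m ln1 by (subst exp_minus, subst exp_add) (simp add: inverse_eq_divide)
  finally have q: "exp (- (((\<nu> * ln m + \<nu> * ln (ln x)) powr (1 / \<nu>)) powr \<nu> / \<nu>)) = 1 / (m * ln x)" .
  \<comment> \<open>Strict positivity of the threshold is what the upper tail bound on a closed ray
    demands.\<close>
  have "\<nu> * ln x + \<nu> * ln (ln x) > 0" using \<nu> ln1 lnln by (intro add_pos_pos mult_pos_pos) auto
  then have "sel_threshold \<nu> x > 0" by simp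
  from expected_hamming_threshold_le[OF F \<mu> \<sigma> a this _ sep]
  show ?thesis unfolding p q by (simp add: add_divide_distrib)
qed

section \<open>The two asymptotic regimes\<close>

theorem theorem10:
  fixes \<nu> \<sigma> :: real and s :: "nat \<Rightarrow> nat" and a :: "nat \<Rightarrow> real"
  assumes nu: "\<nu> \<ge> 1" and sigma: "\<sigma> > 0"
    and s: "\<forall>d\<ge>2. 1 \<le> s d \<and> s d < d"
    and a: "\<forall>d\<ge>2. a d > 0"
  shows
    "(filterlim (\<lambda>d. real d - real (s d)) at_top sequentially \<and>
      (\<forall>\<^sub>F d in sequentially.
         a d \<ge> \<sigma> * (
           (\<nu> * ln (real d - real (s d)) + \<nu> * ln (ln (real d - real (s d)))) powr (1 / \<nu>)
           + (\<nu> * ln (real (s d)) + \<nu> * ln (ln (real d - real (s d)))) powr (1 / \<nu>)))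
      \<longrightarrow>
      limsup (\<lambda>d. SUP F\<in>noise_cdfs \<nu>. SUP \<mu>\<in>sparse_means d (s d) (a d).
        ereal (integral\<^sup>L (obs_law d \<sigma> \<mu> F)
          (\<lambda>X. hamming d (threshold_selector d \<sigma> \<nu> (real d - real (s d)) X) (pattern d \<mu>)))) = 0
      \<and>
      limsup (\<lambda>d. SUP F\<in>noise_cdfs \<nu>. SUP \<mu>\<in>sparse_means d (s d) (a d).
        ereal (measure (obs_law d \<sigma> \<mu> F)
          {X \<in> space (obs_law d \<sigma> \<mu> F).
             supp d (threshold_selector d \<sigma> \<nu> (real d - real (s d)) X) \<noteq> supp d (pattern d \<mu>)})) = 0)
     \<and>
     (filterlim (\<lambda>d. real d / real (s d)) at_top sequentially \<and>
      (\<forall>\<^sub>F d in sequentially.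
         a d \<ge> \<sigma> * (
           (\<nu> * ln (real d / real (s d) - 1) + \<nu> * ln (ln (real d / real (s d) - 1))) powr (1 / \<nu>)
           + (\<nu> * ln (ln (real d / real (s d) - 1))) powr (1 / \<nu>)))
      \<longrightarrow>
      limsup (\<lambda>d. SUP F\<in>noise_cdfs \<nu>. SUP \<mu>\<in>sparse_means d (s d) (a d).
        ereal (1 / real (s d) * integral\<^sup>L (obs_law d \<sigma> \<mu> F)
          (\<lambda>X. hamming d (threshold_selector d \<sigma> \<nu> (real d / real (s d) - 1) X) (pattern d \<mu>)))) = 0)"
proof (intro conjI impI; elim conjE)
  \<comment> \<open>No integer satisfies 1 <= s < d when d < 2, so nonemptiness is claimed only
    eventually.\<close>
  have B: "\<forall>\<^sub>F d in sequentially. sparse_means d (s d) (a d) \<noteq> {}"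
    using eventually_ge_at_top[of 2] by eventually_elim (use s in \<open>auto intro!: sparse_means_nonempty less_imp_le\<close>)
  have c: "(\<lambda>d. 2 / ln (x d)) \<longlonglongrightarrow> 0" if "filterlim x at_top sequentially" for x :: "nat \<Rightarrow> real"
    using that by (intro tendsto_divide_0[OF tendsto_const] filterlim_at_top_imp_at_infinity
        filterlim_compose[OF ln_at_top])
  {
    let ?x = "\<lambda>d. real d - real (s d)"
    let ?E = "\<lambda>d F \<mu>. integral\<^sup>L (obs_law d \<sigma> \<mu> F)
      (\<lambda>X. hamming d (threshold_selector d \<sigma> \<nu> (?x d) X) (pattern d \<mu>))"
    assume x: "filterlim ?x at_top sequentially"
      and sep: "\<forall>\<^sub>F d in sequentially. a d \<ge> \<sigma> * ((\<nu> * ln (?x d) + \<nu> * ln (ln (?x d))) powr (1 / \<nu>)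
           + (\<nu> * ln (real (s d)) + \<nu> * ln (ln (?x d))) powr (1 / \<nu>))"
    have "\<forall>\<^sub>F d in sequentially. ?x d > exp 1"
      using x unfolding filterlim_at_top_dense by blast
    then have E: "\<forall>\<^sub>F d in sequentially. \<forall>F\<in>noise_cdfs \<nu>. \<forall>\<mu>\<in>sparse_means d (s d) (a d). ?E d F \<mu> \<le> 2 / ln (?x d)"
      using sep eventually_ge_at_top[of 2]
    proof eventually_elim
      case (elim d)
      have sd: "1 \<le> s d" "s d < d" "a d > 0" using s a elim by auto
      show ?case
      proof (intro ballI)
        fix F \<mu> assume "F \<in> noise_cdfs \<nu>" "\<mu> \<in> sparse_means d (s d) (a d)"
        \<comment> \<open>With \<open>m = real (s d)\<close> both quotients in the numerator equal
          1; the open premise is \<open>m \<ge> 1\<close>.\<close>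
        from expected_hamming_threshold_le_ln[OF this nu sigma sd(3) elim(1) _ elim(2)] sd
        show "?E d F \<mu> \<le> 2 / ln (?x d)" by simp
      qed
    qed
    show "limsup (\<lambda>d. SUP F\<in>noise_cdfs \<nu>. SUP \<mu>\<in>sparse_means d (s d) (a d). ereal (?E d F \<mu>)) = 0"
      by (rule limsup_SUP_SUP_eq_0[OF noise_cdfs_nonempty[OF nu] B _ E c[OF x]])
        (intro integral_nonneg_AE AE_I2 hamming_nonneg)
    let ?P = "\<lambda>d F \<mu>. measure (obs_law d \<sigma> \<mu> F) {X \<in> space (obs_law d \<sigma> \<mu> F).
      supp d (threshold_selector d \<sigma> \<nu> (?x d) X) \<noteq> supp d (pattern d \<mu>)}"
    have P: "\<forall>\<^sub>F d in sequentially. \<forall>F\<in>noise_cdfs \<nu>. \<forall>\<mu>\<in>sparse_means d (s d) (a d). ?P d F \<mu> \<le> 2 / ln (?x d)"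
      using E by eventually_elim (blast intro: order_trans[OF prob_supp_neq_le_expected_hamming])
    show "limsup (\<lambda>d. SUP F\<in>noise_cdfs \<nu>. SUP \<mu>\<in>sparse_means d (s d) (a d). ereal (?P d F \<mu>)) = 0"
      by (rule limsup_SUP_SUP_eq_0[OF noise_cdfs_nonempty[OF nu] B _ P c[OF x]]) simp
  next
    let ?x = "\<lambda>d. real d / real (s d) - 1"
    let ?E = "\<lambda>d F \<mu>. 1 / real (s d) * integral\<^sup>L (obs_law d \<sigma> \<mu> F)
      (\<lambda>X. hamming d (threshold_selector d \<sigma> \<nu> (?x d) X) (pattern d \<mu>))"
    assume ratio: "filterlim (\<lambda>d. real d / real (s d)) at_top sequentially"
      and sep: "\<forall>\<^sub>F d in sequentially. a d \<ge> \<sigma> * ((\<nu> * ln (?x d) + \<nu> * ln (ln (?x d))) powr (1 / \<nu>)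
           + (\<nu> * ln (ln (?x d))) powr (1 / \<nu>))"
    have x: "filterlim ?x at_top sequentially"
      using filterlim_tendsto_add_at_top[OF tendsto_const[of "-1"] ratio] by simp
    then have "\<forall>\<^sub>F d in sequentially. ?x d > exp 1"
      unfolding filterlim_at_top_dense by blast
    then have E: "\<forall>\<^sub>F d in sequentially. \<forall>F\<in>noise_cdfs \<nu>. \<forall>\<mu>\<in>sparse_means d (s d) (a d). ?E d F \<mu> \<le> 2 / ln (?x d)"
      using sep eventually_ge_at_top[of 2]
    proof eventually_elim
      case (elim d)
      have sd: "1 \<le> s d" "s d < d" "a d > 0" using s a elim by auto
      \<comment> \<open>Here \<open>?x d\<close> equals (d - s)/s, so false positives contribute as
        much as misses to the bound.\<close>
      have "(real d - real (s d)) / ?x d = real (s d)"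
        using sd by (simp add: field_simps)
      moreover have "1 / real (s d) * ((real (s d) + real (s d) / 1) / y) = 2 / y" for y
        using sd by (simp add: add_divide_distrib distrib_left)
      \<comment> \<open>The trivial division by 1 keeps the shape of the lemma at
        \<open>m = 1\<close>, where \<open>ln m\<close> vanishes from the separation
        condition.\<close>
      ultimately have bound: "1 / real (s d) * (((real d - real (s d)) / ?x d + real (s d) / 1) / ln (?x d)) = 2 / ln (?x d)"
        by simp
      show ?case
      proof (intro ballI)
        fix F \<mu> assume *: "F \<in> noise_cdfs \<nu>" "\<mu> \<in> sparse_means d (s d) (a d)"
        show "?E d F \<mu> \<le> 2 / ln (?x d)"
          unfolding bound[symmetric]
          by (intro mult_left_mono expected_hamming_threshold_le_ln[OF * nu sigma sd(3) elim(1)])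
            (use elim(2) in simp_all)
      qed
    qed
    show "limsup (\<lambda>d. SUP F\<in>noise_cdfs \<nu>. SUP \<mu>\<in>sparse_means d (s d) (a d). ereal (?E d F \<mu>)) = 0"
      by (rule limsup_SUP_SUP_eq_0[OF noise_cdfs_nonempty[OF nu] B _ E c[OF x]])
        (intro mult_nonneg_nonneg integral_nonneg_AE AE_I2 hamming_nonneg, simp)
  }
qed

end
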